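(* For every constant $K>0$ there exist constants $c,C>0$ (depending only on $K$) such that for all integers $r\ge 2$ and $n$ with $2r-1\le n\le K r^2$, \[ 2^{c\, r^2/n}\;\le\; f(n,r)\;\le\; 2^{C\,(r^2/n)\log_2(n/r)} \;=\; (n/r)^{C r^2/n}. \] That is, $f(n,r)=2^{\tilde{\Theta}(r^2/n)}$ for $3\le 2r-1\le n\le O(r^2)$, where $\tilde\Theta$ hides a factor logarithmic in $n/r$ in the exponent.
   Context: A hypergraph is $r$-uniform if every edge has exactly $r$ vertices. A hypergraph is intersecting if any two edges have non-empty intersection. The cover number $\tau(H)$ of a hypergraph $H$ is the minimum size of a set of vertices meeting every edge. For integers $n\ge 2r-1\ge 3$, $f(n,r)$ denotes the minimum number of edges in an $n$-vertex $r$-uniform intersecting hypergraph with cover number equal to $r$. *)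

theory Defs
  imports Complex_Main
begin

text \<open>A hypergraph is given by its finite vertex set \<open>V\<close>, which may contain vertices lying
  in no edge, and its set of edges \<open>E\<close>.\<close>

definition hypergraph :: "'a set \<Rightarrow> 'a set set \<Rightarrow> bool" where
  "hypergraph V E \<longleftrightarrow> finite V \<and> (\<forall>e\<in>E. e \<subseteq> V)"

definition uniform :: "nat \<Rightarrow> 'a set set \<Rightarrow> bool" where
  "uniform r E \<longleftrightarrow> (\<forall>e\<in>E. card e = r)"

definition intersecting :: "'a set set \<Rightarrow> bool" where
  "intersecting E \<longleftrightarrow> (\<forall>e\<in>E. \<forall>e'\<in>E. e \<inter> e' \<noteq> {})"

definition vertex_cover :: "'a set \<Rightarrow> 'a set set \<Rightarrow> 'a set \<Rightarrow> bool" where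
  "vertex_cover V E T \<longleftrightarrow> T \<subseteq> V \<and> (\<forall>e\<in>E. T \<inter> e \<noteq> {})"

definition cover_number :: "'a set \<Rightarrow> 'a set set \<Rightarrow> nat" where
  "cover_number V E = (LEAST k. \<exists>T. vertex_cover V E T \<and> card T = k)"

definition admissible :: "nat \<Rightarrow> nat \<Rightarrow> 'a set \<Rightarrow> 'a set set \<Rightarrow> bool" where
  "admissible n r V E \<longleftrightarrow> hypergraph V E \<and> card V = n \<and> uniform r E \<and> intersecting E
     \<and> cover_number V E = r"

text \<open>Vertices are taken to be natural numbers, which is no restriction for finite
  hypergraphs. The set over which the minimum is taken is nonempty for \<open>n \<ge> 2 * r - 1\<close> and
  \<open>r \<ge> 1\<close>; see \<open>admissible_exists\<close>.\<close>

definition min_edges :: "nat \<Rightarrow> nat \<Rightarrow> nat" where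
  "min_edges n r = (LEAST m. \<exists>(V :: nat set) E. admissible n r V E \<and> card E = m)"

lemma admissible_exists:
  assumes r: "r \<ge> 1" and n: "n \<ge> 2 * r - 1"
  shows "\<exists>(V :: nat set) E. admissible n r V E"
proof -
  define W where "W = {..<2 * r - 1}"
  define E where "E = {e. e \<subseteq> W \<and> card e = r}"
  have fW: "finite W" and cW: "card W = 2 * r - 1" and WV: "W \<subseteq> {..<n}"
    using n by (auto simp: W_def)
  have int: "e \<inter> e' \<noteq> {}" if "e \<subseteq> W" "card e = r" "e' \<subseteq> W" "card e' = r" for e e'
  proof
    assume "e \<inter> e' = {}"
    then have "card (e \<union> e') = 2 * r"
      using that finite_subset[OF _ fW] by (simp add: card_Un_disjoint)
    moreover have "card (e \<union> e') \<le> card W"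
      using that fW by (intro card_mono) auto
    ultimately show False using cW r by simp
  qed
  have "cover_number {..<n} E = r"
    unfolding cover_number_def
  proof (rule Least_equality)
    have "{..<r} \<subseteq> W" using r by (auto simp: W_def)
    then have "vertex_cover {..<n} E {..<r}"
      unfolding vertex_cover_def E_def using r n int[of "{..<r}"] by auto
    then show "\<exists>T. vertex_cover {..<n} E T \<and> card T = r"
      by (intro exI[of _ "{..<r}"]) simp
  next
    fix k assume "\<exists>T. vertex_cover {..<n} E T \<and> card T = k"
    then obtain T where T: "vertex_cover {..<n} E T" "card T = k" by blast
    show "r \<le> k"
    proof (rule ccontr)
      assume "\<not> r \<le> k"
      have "finite T" using T(1) finite_subset by (auto simp: vertex_cover_def)
      then have "card W - card T \<le> card (W - T)" by (rule diff_card_le_card_Diff)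
      then have "r \<le> card (W - T)" using T(2) cW \<open>\<not> r \<le> k\<close> by simp
      then obtain e where "e \<subseteq> W - T" "card e = r"
        by (meson obtain_subset_with_card_n)
      then have "e \<in> E" "T \<inter> e = {}" by (auto simp: E_def)
      then show False using T(1) by (auto simp: vertex_cover_def)
    qed
  qed
  then have "admissible n r {..<n} E"
    using WV int by (auto simp: admissible_def hypergraph_def uniform_def intersecting_def E_def)
  then show ?thesis by blast
qed

end

theory Submission
  imports Defs "HOL-Algebra.Algebraic_Closure_Type" "HOL-Library.Z2"
begin

text \<open>
  Lower bound: every edge contains an \<open>r / n\<close> fraction of the vertices, so \<open>r - 1\<close> greedily
  chosen vertices leave at most \<open>(1 - r / n) ^ (r - 1) * card E\<close> edges uncovered, which is less
  than one unless \<open>card E \<ge> exp (r * (r - 1) / n)\<close>.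

  Upper bound: take a projective plane of order \<open>q \<approx> n / r\<close>, replace each point by \<open>2 * s - 1\<close>
  copies with \<open>s \<approx> r / q\<close>, and let an edge consist of \<open>s\<close> copies of every point of a line.
  The remainder of \<open>r\<close> modulo \<open>q + 1\<close> is absorbed by a chain of additional disjoint blocks. A set
  of fewer than \<open>r\<close> vertices leaves some line on which it has weight at most \<open>2 * s\<close> and fewer
  than \<open>s\<close> copies of each point, hence it is missed by a fraction \<open>q powr (- O(s))\<close> of the edges over
  this line. By the same greedy argument, now choosing edges that avoid potential covers,
  \<open>q powr O(s)\<close> edges suffice.
\<close>

section \<open>Greedy hitting sets\<close>

text \<open>Double counting of the pairs \<open>(x, i)\<close> with \<open>x \<in> S i\<close>: some
  point does at least as well as the average.\<close>

lemma greedy_hitting_step: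
  fixes p :: real
  assumes "finite \<Omega>" "\<Omega> \<noteq> {}" "finite I"
    and sub: "\<And>i. i \<in> I \<Longrightarrow> S i \<subseteq> \<Omega>"
    and dens: "\<And>i. i \<in> I \<Longrightarrow> p * card \<Omega> \<le> card (S i)"
  shows "\<exists>x\<in>\<Omega>. p * card I \<le> card {i\<in>I. x \<in> S i}"
proof (rule ccontr)
  assume "\<not> ?thesis"
  then have less: "card {i\<in>I. x \<in> S i} < p * card I" if "x \<in> \<Omega>" for x
    using that by (meson not_le)
  have "(\<Sum>x\<in>\<Omega>. card {i\<in>I. x \<in> S i}) = (\<Sum>i\<in>I. card {x\<in>\<Omega>. x \<in> S i})"
    using sum.swap_restrict[OF assms(1,3), of "\<lambda>_ _. 1::nat" "\<lambda>x i. x \<in> S i"] by simp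
  also have "\<dots> = (\<Sum>i\<in>I. card (S i))"
    using sub by (intro sum.cong arg_cong[where f = card]) auto
  finally have eq: "(\<Sum>x\<in>\<Omega>. real (card {i\<in>I. x \<in> S i})) = (\<Sum>i\<in>I. real (card (S i)))"
    unfolding of_nat_sum[symmetric] by (rule arg_cong)
  have "(\<Sum>x\<in>\<Omega>. real (card {i\<in>I. x \<in> S i})) < (\<Sum>x\<in>\<Omega>. p * card I)"
    using less assms(1,2) by (intro sum_strict_mono) auto
  also have "\<dots> = (\<Sum>i\<in>I. p * card \<Omega>)" by simp
  also have "\<dots> \<le> (\<Sum>i\<in>I. real (card (S i)))"
    using dens by (intro sum_mono)
  finally show False using eq by simp
qed

text \<open>The sets not yet hit still have density \<open>p\<close>, so each further point leaves
  at most a fraction \<open>1 - p\<close> of them.\<close>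

lemma greedy_hitting_set:
  fixes p :: real
  assumes "finite \<Omega>" "\<Omega> \<noteq> {}" "finite I" "p \<le> 1"
    and sub: "\<And>i. i \<in> I \<Longrightarrow> S i \<subseteq> \<Omega>"
    and dens: "\<And>i. i \<in> I \<Longrightarrow> p * card \<Omega> \<le> card (S i)"
  shows "\<exists>Y\<subseteq>\<Omega>. card Y \<le> k \<and> card {i\<in>I. S i \<inter> Y = {}} \<le> (1 - p) ^ k * card I"
proof (induction k)
  case 0
  then show ?case by (intro exI[of _ "{}"]) simp
next
  case (Suc k)
  then obtain Y where Y: "Y \<subseteq> \<Omega>" "card Y \<le> k"
    "card {i\<in>I. S i \<inter> Y = {}} \<le> (1 - p) ^ k * card I" by blast
  define J where "J = {i\<in>I. S i \<inter> Y = {}}"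
  have finJ: "finite J" using assms(3) by (simp add: J_def)
  obtain x where x: "x \<in> \<Omega>" "p * card J \<le> card {i\<in>J. x \<in> S i}"
    using greedy_hitting_step[OF assms(1,2) finJ, of S p] sub dens by (auto simp: J_def)
  have "{i\<in>I. S i \<inter> insert x Y = {}} = J - {i\<in>J. x \<in> S i}" by (auto simp: J_def)
  then have "card {i\<in>I. S i \<inter> insert x Y = {}} = card J - card {i\<in>J. x \<in> S i}"
    using finJ by (simp add: card_Diff_subset)
  moreover have "card {i\<in>J. x \<in> S i} \<le> card J" using finJ by (intro card_mono) auto
  ultimately have "real (card {i\<in>I. S i \<inter> insert x Y = {}}) \<le> (1 - p) * card J"
    using x(2) by (simp add: algebra_simps of_nat_diff)
  also have "\<dots> \<le> (1 - p) * ((1 - p) ^ k * card I)"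
    using Y(3) assms(4) by (intro mult_left_mono) (auto simp: J_def)
  finally have "card {i\<in>I. S i \<inter> insert x Y = {}} \<le> (1 - p) ^ Suc k * card I"
    by (simp add: mult.assoc)
  moreover have "card (insert x Y) \<le> Suc k"
    using Y(2) finite_subset[OF Y(1) assms(1)] by (simp add: card_insert_if)
  ultimately show ?case using Y(1) x(1) by (intro exI[of _ "insert x Y"]) auto
qed

lemma greedy_hitting_set_all:
  fixes p :: real
  assumes "finite \<Omega>" "\<Omega> \<noteq> {}" "finite I" "p \<le> 1"
    and sub: "\<And>i. i \<in> I \<Longrightarrow> S i \<subseteq> \<Omega>"
    and dens: "\<And>i. i \<in> I \<Longrightarrow> p * card \<Omega> \<le> card (S i)"
    and small: "(1 - p) ^ k * card I < 1"
  shows "\<exists>Y\<subseteq>\<Omega>. card Y \<le> k \<and> (\<forall>i\<in>I. S i \<inter> Y \<noteq> {})"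
proof -
  have "\<exists>Y\<subseteq>\<Omega>. card Y \<le> k \<and> card {i\<in>I. S i \<inter> Y = {}} \<le> (1 - p) ^ k * card I"
    by (rule greedy_hitting_set) (fact assms)+
  then obtain Y where Y: "Y \<subseteq> \<Omega>" "card Y \<le> k"
    "card {i\<in>I. S i \<inter> Y = {}} \<le> (1 - p) ^ k * card I"
    by auto
  then have "card {i\<in>I. S i \<inter> Y = {}} = 0" using small by linarith
  then have "{i\<in>I. S i \<inter> Y = {}} = {}" using assms(3) by simp
  then show ?thesis using Y by blast
qed

lemma one_minus_power_le_exp:
  fixes p :: real
  assumes "p \<le> 1"
  shows "(1 - p) ^ k \<le> exp (- p * k)"
proof -
  have "(1 - p) ^ k \<le> exp (- p) ^ k"
    using assms exp_ge_add_one_self[of "- p"] by (intro power_mono) auto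
  then show ?thesis by (simp add: exp_of_nat_mult[symmetric] mult.commute)
qed

lemma two_powr_le_exp: "x \<ge> 0 \<Longrightarrow> 2 powr x \<le> exp x" for x :: real
  using ln_2_less_1 by (simp add: powr_def mult_left_le)

section \<open>The minimum number of edges\<close>

lemma cover_number_le:
  assumes "vertex_cover V E T"
  shows "cover_number V E \<le> card T"
  unfolding cover_number_def using assms by (intro Least_le) blast

lemma admissible_card_edges_ge:
  assumes adm: "admissible n r V E" and r: "r \<ge> 2"
  shows "2 powr (1 / 2 * (real r)\<^sup>2 / real n) \<le> card E"
proof -
  have V: "finite V" "card V = n" "\<And>e. e \<in> E \<Longrightarrow> e \<subseteq> V" and E: "\<And>e. e \<in> E \<Longrightarrow> card e = r"
    and tau: "cover_number V E = r"
    using adm by (auto simp: admissible_def hypergraph_def uniform_def)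
  have finE: "finite E" using V by (meson Pow_iff finite_Pow_iff finite_subset subsetI)
  \<comment> \<open>Without edges the empty set would be a cover of size 0.\<close>
  have "E \<noteq> {}"
    using cover_number_le[of V E "{}"] tau r by (auto simp: vertex_cover_def)
  then obtain e where "e \<in> E" by blast
  then have rn: "r \<le> n" using V E card_mono by metis
  then have n: "n > 0" and Vne: "V \<noteq> {}" using r V(2) by auto
  define p where "p = real r / n"
  have p1: "p \<le> 1" using rn n by (simp add: p_def)
  \<comment> \<open>Otherwise \<open>r - 1\<close> greedily chosen vertices would form a cover,
    against cover number \<open>r\<close>.\<close>
  have "1 \<le> (1 - p) ^ (r - 1) * card E"
  proof (rule ccontr)
    assume "\<not> ?thesis"
    then have small: "(1 - p) ^ (r - 1) * card E < 1" by simp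
    have "p * card V \<le> card e" if "e \<in> E" for e
      using that E V(2) n by (simp add: p_def)
    then obtain Y where "Y \<subseteq> V" "card Y \<le> r - 1" "\<forall>e\<in>E. e \<inter> Y \<noteq> {}"
      using greedy_hitting_set_all[OF V(1) Vne finE p1, of "\<lambda>e. e", OF V(3) _ small] by blast
    then have "vertex_cover V E Y" by (auto simp: vertex_cover_def)
    from cover_number_le[OF this] show False
      using tau \<open>card Y \<le> r - 1\<close> r by linarith
  qed
  also have "\<dots> \<le> exp (- p * (r - 1)) * card E"
    using one_minus_power_le_exp[OF p1, of "r - 1"] by (intro mult_right_mono) auto
  finally have "exp (p * (r - 1)) \<le> card E"
    by (simp add: exp_minus field_simps)
  \<comment> \<open>The factor 1/2 pays for replacing \<open>r - 1\<close> by \<open>r\<close>, as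
    \<open>r \<ge> 2\<close>.\<close>
  moreover have "1 / 2 * (real r)\<^sup>2 / real n \<le> p * real (r - 1)"
  proof -
    have "real r / 2 \<le> real (r - 1)" using r by (simp add: of_nat_diff)
    then have "real r / n * (real r / 2) \<le> real r / n * real (r - 1)"
      by (intro mult_left_mono) auto
    then show ?thesis by (simp add: p_def power2_eq_square)
  qed
  then have "exp (1 / 2 * (real r)\<^sup>2 / real n) \<le> exp (p * real (r - 1))" by simp
  moreover have "2 powr (1 / 2 * (real r)\<^sup>2 / real n) \<le> exp (1 / 2 * (real r)\<^sup>2 / real n)"
    by (rule two_powr_le_exp) simp
  ultimately show ?thesis by linarith
qed

lemma min_edges_attained:
  assumes "r \<ge> 1" "n \<ge> 2 * r - 1"
  shows "\<exists>(V :: nat set) E. admissible n r V E \<and> card E = min_edges n r"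
  unfolding min_edges_def
  by (rule LeastI_ex) (use admissible_exists[OF assms] in blast)

text \<open>Interface for constructions: vertices may have any type, missing vertices are added as
  isolated ones, and only the lower bound on the cover number has to be supplied.\<close>

lemma min_edges_le:
  fixes W :: "'v set"
  assumes W: "finite W" "card W \<le> n" and E: "\<And>e. e \<in> E \<Longrightarrow> e \<subseteq> W" "\<And>e. e \<in> E \<Longrightarrow> card e = r"
    and int: "intersecting E"
    and cover: "\<And>T. T \<subseteq> W \<Longrightarrow> card T < r \<Longrightarrow> \<exists>e\<in>E. e \<inter> T = {}"
    and r: "r \<ge> 1"
  shows "min_edges n r \<le> card E"
proof -
  obtain f :: "'v \<Rightarrow> nat" where f: "inj_on f W" "f ` W \<subseteq> {..<n}"
    using card_le_inj[OF W(1), of "{..<n}"] W(2) by auto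
  have finE: "finite E" using W E(1) by (meson Pow_iff finite_Pow_iff finite_subset subsetI)
  define E' where "E' = (`) f ` E"
  have "hypergraph {..<n} E'" using E(1) f(2) by (force simp: hypergraph_def E'_def)
  moreover have unif: "uniform r E'"
    using E f(1) by (auto simp: uniform_def E'_def card_image inj_on_subset)
  moreover have int': "intersecting E'"
    using int by (fastforce simp: intersecting_def E'_def)
  moreover have "cover_number {..<n} E' = r"
    unfolding cover_number_def
  proof (rule Least_equality)
    \<comment> \<open>In an intersecting hypergraph every edge is itself a cover.\<close>
    obtain e where e: "e \<in> E" using cover[of "{}"] r by auto
    then have "f ` e \<subseteq> {..<n}" using E(1) f(2) by blast
    then have "vertex_cover {..<n} E' (f ` e)"
      using int' e by (auto simp: vertex_cover_def intersecting_def E'_def)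
    moreover have "card (f ` e) = r" using unif e by (auto simp: uniform_def E'_def)
    ultimately show "\<exists>T. vertex_cover {..<n} E' T \<and> card T = r" by blast
  next
    fix k assume "\<exists>T. vertex_cover {..<n} E' T \<and> card T = k"
    then obtain T where T: "vertex_cover {..<n} E' T" "card T = k" by blast
    have finT: "finite T" using T(1) by (meson finite_lessThan finite_subset vertex_cover_def)
    define T' where "T' = {x\<in>W. f x \<in> T}"
    have "card T' = card (f ` T')"
      using f(1) by (auto simp: T'_def card_image inj_on_subset)
    also have "\<dots> \<le> k" unfolding T(2)[symmetric] using finT by (intro card_mono) (auto simp: T'_def)
    finally have "card T' \<le> k" .
    show "r \<le> k"
    proof (rule ccontr)
      assume "\<not> r \<le> k"
      then obtain e where e: "e \<in> E" "e \<inter> T' = {}"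
        using cover[of T'] \<open>card T' \<le> k\<close> by (auto simp: T'_def)
      have "T \<inter> f ` e \<noteq> {}" using T(1) e(1) by (auto simp: vertex_cover_def E'_def)
      then show False using e E(1)[OF e(1)] by (auto simp: T'_def)
    qed
  qed
  ultimately have "admissible n r {..<n} E'" by (simp add: admissible_def)
  then have "min_edges n r \<le> card E'"
    unfolding min_edges_def by (intro Least_le) blast
  also have "\<dots> \<le> card E" unfolding E'_def using finE by (rule card_image_le)
  finally show ?thesis .
qed

text \<open>Isolated vertices can be added without changing the cover number.\<close>

lemma min_edges_antimono:
  assumes r: "r \<ge> 1" and n: "2 * r - 1 \<le> n'" "n' \<le> n"
  shows "min_edges n r \<le> min_edges n' r"
proof -
  obtain V :: "nat set" and E where VE: "admissible n' r V E" "card E = min_edges n' r"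
    using min_edges_attained[OF r n(1)] by blast
  have "min_edges n r \<le> card E"
  proof (rule min_edges_le[of V])
    fix T assume T: "T \<subseteq> V" "card T < r"
    have "\<not> vertex_cover V E T"
      using cover_number_le[of V E T] VE(1) T(2) by (auto simp: admissible_def)
    then show "\<exists>e\<in>E. e \<inter> T = {}" using T(1) by (auto simp: vertex_cover_def)
  qed (use VE(1) n r in \<open>auto simp: admissible_def hypergraph_def uniform_def\<close>)
  then show ?thesis using VE(2) by simp
qed

lemma min_edges_le_two_power:
  assumes r: "r \<ge> 1" and n: "2 * r - 1 \<le> n"
  shows "min_edges n r \<le> 2 ^ (2 * r - 1)"
proof -
  obtain V :: "nat set" and E where VE: "admissible (2 * r - 1) r V E"
    "card E = min_edges (2 * r - 1) r"
    using min_edges_attained[OF r order.refl] by blast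
  then have "finite V" "card V = 2 * r - 1" "E \<subseteq> Pow V"
    by (auto simp: admissible_def hypergraph_def)
  then have "card E \<le> 2 ^ (2 * r - 1)"
    by (metis card_Pow card_mono finite_Pow_iff)
  then show ?thesis using min_edges_antimono[OF r order.refl n] VE(2) by simp
qed

section \<open>Hypergraphs sampled from profiles\<close>

text \<open>The vertex set is split into blocks of sizes \<open>b a\<close>, and a profile \<open>d\<close> prescribes that an
  edge has \<open>d a\<close> vertices in block \<open>a\<close>. If \<open>w a\<close> counts the vertices of \<open>T\<close> in block \<open>a\<close>, the
  product in the last hypothesis is the probability that a random edge of profile \<open>d\<close> misses
  \<open>T\<close>, so a small sample of edges of each profile already defeats every \<open>T\<close> with fewer than
  \<open>r\<close> vertices.\<close>

lemma profile_min_edges: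
  fixes b :: "'i \<Rightarrow> nat" and D :: "('i \<Rightarrow> nat) set"
  assumes I: "finite I" and D: "finite D" and r: "r \<ge> 1"
    and size: "(\<Sum>a\<in>I. b a) = N" "1 \<le> N" "N \<le> n"
    and unif: "\<And>d. d \<in> D \<Longrightarrow> (\<Sum>a\<in>I. d a) = r"
    and int: "\<And>d d'. d \<in> D \<Longrightarrow> d' \<in> D \<Longrightarrow> \<exists>a\<in>I. b a < d a + d' a"
    and miss: "\<And>w. (\<And>a. a \<in> I \<Longrightarrow> w a \<le> b a) \<Longrightarrow> (\<Sum>a\<in>I. w a) < r \<Longrightarrow>
      \<exists>d\<in>D. p \<le> (\<Prod>a\<in>I. real (b a - w a choose d a) / real (b a choose d a))"
    and p: "0 < p" "p \<le> 1" and k: "real N / p \<le> real k"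
  shows "min_edges n r \<le> card D * k"
proof -
  define W where "W = (SIGMA a:I. {..<b a})"
  define block where "block a = {a} \<times> {..<b a}" for a
  \<comment> \<open>An edge of profile \<open>d\<close> is encoded by its traces on the blocks:
    \<open>F d a\<close> lists the possible traces, \<open>\<Omega> d\<close> the families of
    traces, and \<open>U f\<close> is the edge itself.\<close>
  define F where "F d a = {Y. Y \<subseteq> block a \<and> card Y = d a}" for d :: "'i \<Rightarrow> nat" and a
  define \<Omega> where "\<Omega> d = PiE I (F d)" for d
  define U where "U f = (\<Union>a\<in>I. f a)" for f :: "'i \<Rightarrow> ('i \<times> nat) set"
  define \<T> where "\<T> = {T. T \<subseteq> W \<and> card T < r}"
  define frac where "frac d T = (\<Prod>a\<in>I. real (b a - card (T \<inter> block a) choose d a) / real (b a choose d a))"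
    for d :: "'i \<Rightarrow> nat" and T
  have finW: "finite W" and cW: "card W = N" using I size by (auto simp: W_def card_SigmaI)
  have fin_block: "finite (block a)" and card_block: "card (block a) = b a" for a
    by (auto simp: block_def card_cartesian_product)
  have finF: "finite (F d a)" and card_F: "card (F d a) = (b a choose d a)" for d a
    using n_subsets[OF fin_block, of a "d a"] by (auto simp: F_def fin_block card_block)
  have fin_T: "finite \<T>" using finW by (simp add: \<T>_def)
  have card_T: "card \<T> \<le> 2 ^ N"
  proof -
    have "card \<T> \<le> card (Pow W)" using finW by (intro card_mono) (auto simp: \<T>_def)
    then show ?thesis using finW cW by (simp add: card_Pow)
  qed
  have fin_Om: "finite (\<Omega> d)" for d unfolding \<Omega>_def using I finF by (intro finite_PiE)
  have f_card: "finite (f a)" "card (f a) = d a" "f a \<subseteq> block a" if "f \<in> \<Omega> d" "a \<in> I" for f d a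
  proof -
    have "f a \<in> F d a" using that by (auto simp: \<Omega>_def)
    then show "card (f a) = d a" "f a \<subseteq> block a" by (auto simp: F_def)
    then show "finite (f a)" using fin_block by (metis finite_subset)
  qed
  have edge_W: "U f \<subseteq> W" if "f \<in> \<Omega> d" for f d
  proof
    fix x assume "x \<in> U f"
    then obtain a where "a \<in> I" "x \<in> f a" by (auto simp: U_def)
    then show "x \<in> W" using f_card(3)[OF that] by (auto simp: block_def W_def)
  qed
  \<comment> \<open>The greedy argument with reversed roles: the points are edges, and each
    candidate cover \<open>T\<close> contributes the set of edges that avoid it.\<close>
  have sample: "\<exists>Y\<subseteq>\<Omega> d. card Y \<le> k \<and> (\<forall>T\<in>{T\<in>\<T>. p \<le> frac d T}. {f\<in>\<Omega> d. U f \<inter> T = {}} \<inter> Y \<noteq> {})"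
    for d
  proof (cases "{T\<in>\<T>. p \<le> frac d T} = {}")
    case True
    then show ?thesis by (intro exI[of _ "{}"]) auto
  next
    case False
    then obtain T0 where "p \<le> frac d T0" by blast
    \<comment> \<open>A vanishing denominator would make its factor 0, so a positive product shows
      that edges of profile \<open>d\<close> exist.\<close>
    then have "frac d T0 \<noteq> 0" using p by linarith
    then have "\<forall>a\<in>I. b a choose d a \<noteq> 0" using I by (auto simp: frac_def)
    then have Fne: "card (F d a) \<noteq> 0" if "a \<in> I" for a using card_F that by simp
    have card_Om: "card (\<Omega> d) = (\<Prod>a\<in>I. b a choose d a)"
      using I by (simp add: \<Omega>_def card_PiE card_F)
    have "card (\<Omega> d) \<noteq> 0" using Fne I by (simp add: card_Om card_F)
    then have Om_ne: "\<Omega> d \<noteq> {}" by auto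
    show ?thesis
    proof (rule greedy_hitting_set_all[OF fin_Om Om_ne _ p(2)])
      fix T assume "T \<in> {T\<in>\<T>. p \<le> frac d T}"
      then have pT: "p \<le> frac d T" by simp
      have "{f\<in>\<Omega> d. U f \<inter> T = {}} = PiE I (\<lambda>a. {Y. Y \<subseteq> block a - T \<and> card Y = d a})"
      proof (intro Set.set_eqI iffI)
        fix f assume "f \<in> {f\<in>\<Omega> d. U f \<inter> T = {}}"
        then show "f \<in> PiE I (\<lambda>a. {Y. Y \<subseteq> block a - T \<and> card Y = d a})"
          by (auto simp: \<Omega>_def F_def U_def PiE_iff)
      next
        fix f assume "f \<in> PiE I (\<lambda>a. {Y. Y \<subseteq> block a - T \<and> card Y = d a})"
        then show "f \<in> {f\<in>\<Omega> d. U f \<inter> T = {}}"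
          by (auto simp: \<Omega>_def F_def U_def PiE_iff)
      qed
      moreover have "card {Y. Y \<subseteq> block a - T \<and> card Y = d a} = (b a - card (T \<inter> block a) choose d a)" for a
      proof -
        have "card (block a - T) = b a - card (T \<inter> block a)"
          using card_Diff_subset_Int[of "block a" T] fin_block card_block by (simp add: Int_commute)
        then show ?thesis using n_subsets[of "block a - T" "d a"] fin_block by simp
      qed
      ultimately have "card {f\<in>\<Omega> d. U f \<inter> T = {}} = (\<Prod>a\<in>I. b a - card (T \<inter> block a) choose d a)"
        using I by (simp add: card_PiE)
      then have "frac d T = card {f\<in>\<Omega> d. U f \<inter> T = {}} / card (\<Omega> d)"
        by (simp add: frac_def card_Om prod_dividef)
      then have "frac d T * card (\<Omega> d) = card {f\<in>\<Omega> d. U f \<inter> T = {}}"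
        using \<open>card (\<Omega> d) \<noteq> 0\<close> by simp
      then show "p * card (\<Omega> d) \<le> card {f\<in>\<Omega> d. U f \<inter> T = {}}"
        using mult_right_mono[OF pT, of "card (\<Omega> d)"] by simp
    next
      have "real (card {T\<in>\<T>. p \<le> frac d T}) \<le> card \<T>"
        using fin_T by (intro of_nat_mono card_mono) auto
      also have "\<dots> \<le> 2 ^ N" using card_T by (metis of_nat_le_iff of_nat_numeral of_nat_power)
      finally have "(1 - p) ^ k * card {T\<in>\<T>. p \<le> frac d T} \<le> exp (- p * k) * 2 ^ N"
        using one_minus_power_le_exp[OF p(2), of k] p(2) by (intro mult_mono) auto
      \<comment> \<open>The sample size \<open>k \<ge> N / p\<close> beats the \<open>2 ^ N\<close>
        candidate covers because \<open>2 < exp 1\<close>.\<close>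
      also have "\<dots> \<le> exp (- real N) * 2 ^ N"
        using k p(1) by (simp add: field_simps)
      also have "\<dots> = (2 / exp 1) ^ N"
        by (simp add: power_divide exp_of_nat_mult[symmetric] exp_minus field_simps)
      also have "\<dots> < 1"
      proof -
        have "exp (ln 2) < exp (1::real)" using ln_2_less_1 by (simp only: exp_less_cancel_iff)
        then show ?thesis using size(2) by (intro power_less_one_iff[THEN iffD2]) auto
      qed
      finally show "(1 - p) ^ k * card {T\<in>\<T>. p \<le> frac d T} < 1" .
    qed (use fin_T in auto)
  qed
  have "\<exists>Y. \<forall>d. Y d \<subseteq> \<Omega> d \<and> card (Y d) \<le> k \<and>
      (\<forall>T\<in>{T\<in>\<T>. p \<le> frac d T}. {f\<in>\<Omega> d. U f \<inter> T = {}} \<inter> Y d \<noteq> {})"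
    by (intro choice allI sample)
  then obtain Y where Y0: "\<forall>d. Y d \<subseteq> \<Omega> d \<and> card (Y d) \<le> k \<and>
      (\<forall>T\<in>{T\<in>\<T>. p \<le> frac d T}. {f\<in>\<Omega> d. U f \<inter> T = {}} \<inter> Y d \<noteq> {})" ..
  have Y: "Y d \<subseteq> \<Omega> d" "card (Y d) \<le> k"
    "T \<in> \<T> \<Longrightarrow> p \<le> frac d T \<Longrightarrow> {f\<in>\<Omega> d. U f \<inter> T = {}} \<inter> Y d \<noteq> {}" for d T
    using Y0[rule_format, of d] by auto
  define E where "E = (\<Union>d\<in>D. U ` Y d)"
  have finX: "finite (Y d)" for d
    using Y(1) fin_Om by (rule finite_subset)
  have E_cases: "\<exists>d\<in>D. \<exists>f\<in>\<Omega> d. e = U f" if "e \<in> E" for e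
    using that Y(1) by (auto simp: E_def)
  have "min_edges n r \<le> card E"
  proof (rule min_edges_le[of W])
    show "finite W" "card W \<le> n" "r \<ge> 1" using finW cW size r by auto
    show "e \<subseteq> W" if "e \<in> E" for e using E_cases[OF that] edge_W by blast
    show "card e = r" if e: "e \<in> E" for e
    proof -
      obtain d f where df: "d \<in> D" "f \<in> \<Omega> d" "e = U f" using E_cases[OF e] by blast
      have "card (U f) = (\<Sum>a\<in>I. card (f a))"
        unfolding U_def
      proof (rule card_UN_disjoint[OF I])
        show "\<forall>a\<in>I. finite (f a)" using f_card df by blast
        show "\<forall>a\<in>I. \<forall>a'\<in>I. a \<noteq> a' \<longrightarrow> f a \<inter> f a' = {}"
        proof (intro ballI impI)
          fix a a' assume a: "a \<in> I" "a' \<in> I" "a \<noteq> a'"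
          then have "block a \<inter> block a' = {}" by (auto simp: block_def)
          then show "f a \<inter> f a' = {}" using f_card(3)[OF df(2)] a by blast
        qed
      qed
      also have "\<dots> = (\<Sum>a\<in>I. d a)" using f_card df by (intro sum.cong) auto
      finally show ?thesis using unif df by simp
    qed
    show "intersecting E"
      unfolding intersecting_def
    proof (intro ballI)
      fix e e' assume "e \<in> E" "e' \<in> E"
      then obtain d f d' f' where df: "d \<in> D" "f \<in> \<Omega> d" "e = U f" "d' \<in> D" "f' \<in> \<Omega> d'" "e' = U f'"
        using E_cases by metis
      obtain a where a: "a \<in> I" "b a < d a + d' a" using int[OF df(1,4)] by blast
      have "f a \<inter> f' a \<noteq> {}"
      proof
        assume "f a \<inter> f' a = {}"
        then have "d a + d' a = card (f a \<union> f' a)"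
          using f_card a df by (simp add: card_Un_disjoint)
        also have "\<dots> \<le> card (block a)"
          using f_card a df fin_block by (intro card_mono) auto
        finally show False using a card_block by simp
      qed
      then show "e \<inter> e' \<noteq> {}" using df a by (auto simp: U_def)
    qed
    show "\<exists>e\<in>E. e \<inter> T = {}" if T: "T \<subseteq> W" "card T < r" for T
    proof -
      define w where "w a = card (T \<inter> block a)" for a
      have "T = (\<Union>a\<in>I. T \<inter> block a)" using T(1) by (auto simp: W_def block_def)
      moreover have "card (\<Union>a\<in>I. T \<inter> block a) = (\<Sum>a\<in>I. w a)"
        unfolding w_def using I fin_block by (intro card_UN_disjoint) (auto simp: block_def)
      ultimately have "(\<Sum>a\<in>I. w a) < r" using T(2) by simp
      moreover have "w a \<le> b a" for a
        unfolding w_def card_block[symmetric] using fin_block by (intro card_mono) auto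
      ultimately obtain d where "d \<in> D" "p \<le> frac d T"
        using miss[of w] by (auto simp: frac_def w_def)
      then show ?thesis using Y(3)[of T d] T by (auto simp: \<T>_def E_def)
    qed
  qed
  also have "card E \<le> (\<Sum>d\<in>D. card (U ` Y d))"
    unfolding E_def using D by (rule card_UN_le)
  also have "\<dots> \<le> (\<Sum>d\<in>D. k)"
    by (intro sum_mono le_trans[OF card_image_le[OF finX] Y(2)])
  finally show ?thesis by simp
qed

section \<open>Projective planes of order a power of two\<close>

lemma two_eq_0_alg_closure_bit: "(2 :: bit alg_closure) = 0"
proof -
  have "to_ac (2 :: bit) = (0 :: bit alg_closure)"
    by (simp only: bit_2_eq_0 to_ac_0)
  then show ?thesis by (simp only: to_ac_numeral)
qed

lemma order_le_1_if_pderiv_nonzero: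
  fixes p :: "'a :: idom poly"
  assumes "p \<noteq> 0" "poly (pderiv p) a \<noteq> 0"
  shows "order a p \<le> 1"
proof (rule ccontr)
  assume "\<not> order a p \<le> 1"
  then have "[:-a, 1:] ^ 2 dvd p"
    by (simp add: assms(1) order_divides)
  then obtain g where "p = [:-a, 1:] ^ 2 * g" by (elim dvdE)
  then have "p = [:-a, 1:] * ([:-a, 1:] * g)"
    by (simp only: power2_eq_square mult.assoc)
  then have "poly (pderiv p) a = 0"
    by (simp add: pderiv_mult del: mult_pCons_left mult_pCons_right)
  then show False using assms(2) by simp
qed

text \<open>Over an algebraically closed field the roots counted with multiplicity number
  \<open>degree p\<close>; a multiple root would also be a root of the derivative.\<close>

lemma card_roots_alg_closed:
  fixes p :: "'a :: alg_closed_field poly"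
  assumes "p \<noteq> 0" and "\<And>a. poly (pderiv p) a \<noteq> 0"
  shows "card {x. poly p x = 0} = degree p"
proof -
  obtain A where A: "size A = degree p" "p = smult (lead_coeff p) (\<Prod>x\<in>#A. [:-x, 1:])"
    using alg_closed_imp_factorization[OF assms(1)] by blast
  have ne: "lead_coeff p \<noteq> 0" using assms(1) by simp
  have "proots (\<Prod>x\<in>#A. [:-x, 1:]) = A"
  proof (induction A)
    case (add x A)
    have "(\<Prod>x\<in>#A. [:-x, 1:]) \<noteq> 0" by (auto simp: prod_mset_zero_iff)
    then have "proots ([:-x, 1:] * (\<Prod>x\<in>#A. [:-x, 1:])) = add_mset x A"
      using add by (subst proots_mult) auto
    then show ?case by simp
  qed simp
  then have eq: "proots p = A"
    using A(2) ne by (metis proots_smult)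
  have "size (proots p) = (\<Sum>x | poly p x = 0. order x p)"
    using assms(1) by (simp add: size_multiset_overloaded_eq)
  also have "\<dots> = (\<Sum>x | poly p x = 0. 1)"
  proof (rule sum.cong[OF refl])
    fix x assume "x \<in> {x. poly p x = 0}"
    then have "order x p > 0" using assms(1) by (simp add: order_gt_0_iff)
    then show "order x p = 1"
      using order_le_1_if_pderiv_nonzero[OF assms(1) assms(2)[of x]] by linarith
  qed
  finally show ?thesis using A(1) eq by simp
qed

text \<open>The field with \<open>2 ^ k\<close> elements for \<open>k \<ge> 1\<close>, as the fixed
  points of the \<open>k\<close>-th power of the Frobenius map. Being a set and not a type, it can
  depend on the variable \<open>k\<close>.\<close>

definition fixed_field :: "nat \<Rightarrow> bit alg_closure set" where
  "fixed_field k = {x. x ^ 2 ^ k = x}"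

lemma card_fixed_field:
  assumes "k \<ge> 1"
  shows "card (fixed_field k) = 2 ^ k"
proof -
  define p :: "bit alg_closure poly" where "p = monom 1 (2 ^ k) - monom 1 1"
  have "(2::nat) ^ 1 \<le> 2 ^ k" using assms by (intro power_increasing) auto
  then have k2: "(2::nat) ^ k > 1" by simp
  have "degree p = 2 ^ k"
    unfolding p_def diff_conv_add_uminus using k2
    by (subst degree_add_eq_left) (auto simp: degree_monom_eq)
  have p0: "p \<noteq> 0" using \<open>degree p = 2 ^ k\<close> by auto
  \<comment> \<open>The leading term has derivative zero in characteristic two, so the derivative is
    the nonzero constant \<open>- 1\<close>.\<close>
  have "of_nat (2 ^ k) = (0 :: bit alg_closure)"
    using assms by (simp add: two_eq_0_alg_closure_bit)
  then have "pderiv p = - 1"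
    unfolding p_def by (simp add: pderiv_diff pderiv_monom)
  then have "card {x. poly p x = 0} = degree p"
    by (intro card_roots_alg_closed p0) simp
  moreover have "{x. poly p x = 0} = fixed_field k"
    by (auto simp: p_def fixed_field_def poly_monom)
  ultimately show ?thesis using \<open>degree p = 2 ^ k\<close> by simp
qed

lemma add_two_power_alg_closure_bit:
  "(x + y) ^ 2 ^ k = x ^ 2 ^ k + y ^ 2 ^ k" for x y :: "bit alg_closure"
proof (induction k)
  case (Suc k)
  have "(x + y) ^ 2 ^ Suc k = (x ^ 2 ^ k + y ^ 2 ^ k)\<^sup>2"
    using Suc by (simp add: power_mult mult.commute[of 2])
  also have "\<dots> = (x ^ 2 ^ k)\<^sup>2 + (y ^ 2 ^ k)\<^sup>2"
    by (simp add: power2_sum two_eq_0_alg_closure_bit)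
  finally show ?case by (simp add: power_mult mult.commute[of 2])
qed simp

text \<open>The map \<open>x \<mapsto> x ^ 2 ^ k\<close> respects sums, products and quotients, and
  subtraction is addition in characteristic two.\<close>

lemma fixed_field_closed:
  assumes "x \<in> fixed_field k" "y \<in> fixed_field k"
  shows "x - y \<in> fixed_field k" "x * y \<in> fixed_field k" "x / y \<in> fixed_field k"
proof -
  have x: "x ^ 2 ^ k = x" and y: "y ^ 2 ^ k = y"
    using assms unfolding fixed_field_def by simp_all
  have "y + y = 0"
    using mult_2[of y] unfolding two_eq_0_alg_closure_bit mult_zero_left by (rule sym)
  then have "x - y = x + y"
    using minus_unique[of y y] by (metis diff_conv_add_uminus)
  then show "x - y \<in> fixed_field k"
    unfolding fixed_field_def mem_Collect_eq by (simp only: add_two_power_alg_closure_bit x y)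
  show "x * y \<in> fixed_field k" "x / y \<in> fixed_field k"
    unfolding fixed_field_def mem_Collect_eq by (simp_all only: power_mult_distrib power_divide x y)
qed

text \<open>A projective plane of order \<open>q\<close> with a polarity, so that a line is named by its pole and
  \<open>inc x y\<close> says that the point \<open>x\<close> lies on the line with pole \<open>y\<close>.\<close>

definition polar_plane :: "nat \<Rightarrow> 'p set \<Rightarrow> ('p \<Rightarrow> 'p \<Rightarrow> bool) \<Rightarrow> bool" where
  "polar_plane q P inc \<longleftrightarrow> finite P \<and> card P = q\<^sup>2 + q + 1 \<and>
     (\<forall>x\<in>P. \<forall>y\<in>P. inc x y \<longrightarrow> inc y x) \<and>
     (\<forall>x\<in>P. card {y\<in>P. inc x y} = q + 1) \<and>
     (\<forall>x\<in>P. \<forall>y\<in>P. \<exists>z\<in>P. inc x z \<and> inc y z)"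

text \<open>Projective completion of the affine plane. As points, \<open>Slope a\<close> is the
  direction of slope \<open>a\<close> and \<open>Infty\<close> the vertical direction; as a pole,
  \<open>Infty\<close> names the line at infinity.\<close>

datatype 'a pt = Aff 'a 'a | Slope 'a | Infty

text \<open>The line with pole \<open>Aff m b\<close> is \<open>y = m * x - b\<close> and the line with pole \<open>Slope a\<close>
  is \<open>x = a\<close>; the minus sign makes the relation symmetric.\<close>

fun incident :: "'a :: field pt \<Rightarrow> 'a pt \<Rightarrow> bool" where
  "incident (Aff x y) (Aff m b) \<longleftrightarrow> y + b = m * x"
| "incident (Aff x y) (Slope a) \<longleftrightarrow> x = a"
| "incident (Slope a) (Aff x y) \<longleftrightarrow> x = a"
| "incident (Slope a) Infty \<longleftrightarrow> True"
| "incident Infty (Slope a) \<longleftrightarrow> True"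
| "incident Infty Infty \<longleftrightarrow> True"
| "incident _ _ \<longleftrightarrow> False"

lemma incident_commute: "incident u v \<longleftrightarrow> incident v u"
  by (cases u; cases v) (auto simp: algebra_simps)

lemma polar_plane_of_field:
  fixes F :: "'a :: field set"
  assumes fin: "finite F"
    and closed: "\<And>x y. x \<in> F \<Longrightarrow> y \<in> F \<Longrightarrow> x - y \<in> F"
      "\<And>x y. x \<in> F \<Longrightarrow> y \<in> F \<Longrightarrow> x * y \<in> F" "\<And>x y. x \<in> F \<Longrightarrow> y \<in> F \<Longrightarrow> x / y \<in> F"
  defines "P \<equiv> case_prod Aff ` (F \<times> F) \<union> Slope ` F \<union> {Infty}"
  shows "polar_plane (card F) P incident"
proof -
  have P_simps [simp]: "Aff x y \<in> P \<longleftrightarrow> x \<in> F \<and> y \<in> F" "Slope x \<in> P \<longleftrightarrow> x \<in> F" "Infty \<in> P" for x y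
    by (auto simp: P_def)
  have finP: "finite P" using fin by (simp add: P_def)
  have "card P = card F * card F + card F + 1"
  proof -
    have "inj_on (case_prod (Aff :: 'a \<Rightarrow> _)) (F \<times> F)" by (auto simp: inj_on_def)
    then have a: "card (case_prod Aff ` (F \<times> F)) = card F * card F"
      by (simp add: card_image card_cartesian_product)
    have b: "card (Slope ` F) = card F" by (simp add: card_image inj_on_def)
    have "card (case_prod Aff ` (F \<times> F) \<union> Slope ` F) = card F * card F + card F"
      using fin a b by (subst card_Un_disjoint) auto
    then show ?thesis
      unfolding P_def using fin by (subst card_Un_disjoint) auto
  qed
  moreover have "card {v\<in>P. incident u v} = card F + 1" if "u \<in> P" for u
  proof (cases u)
    case (Aff x y)
    have "{v\<in>P. incident u v} = insert (Slope x) ((\<lambda>m. Aff m (m * x - y)) ` F)"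
    proof (intro Set.set_eqI)
      fix v
      show "v \<in> {v\<in>P. incident u v} \<longleftrightarrow> v \<in> insert (Slope x) ((\<lambda>m. Aff m (m * x - y)) ` F)"
      proof (cases v)
        case (Aff m b)
        have "y + b = m * x \<longleftrightarrow> b = m * x - y" by (auto simp: algebra_simps)
        then show ?thesis using that closed \<open>u = Aff x y\<close> Aff by auto
      qed (use that Aff in auto)
    qed
    moreover have "card ((\<lambda>m. Aff m (m * x - y)) ` F) = card F"
      by (simp add: card_image inj_on_def)
    moreover have "Slope x \<notin> (\<lambda>m. Aff m (m * x - y)) ` F" by auto
    ultimately show ?thesis using fin by simp
  next
    case (Slope a)
    have "{v\<in>P. incident u v} = insert Infty (Aff a ` F)"
      using that Slope by (auto simp: P_def)
    moreover have "card (Aff a ` F) = card F"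
      by (simp add: card_image inj_on_def)
    moreover have "Infty \<notin> Aff a ` F" by auto
    ultimately show ?thesis using fin by simp
  next
    case Infty
    have "{v\<in>P. incident u v} = insert Infty (Slope ` F)"
      using Infty by (auto simp: P_def)
    moreover have "card (Slope ` F) = card F"
      by (simp add: card_image inj_on_def)
    moreover have "Infty \<notin> Slope ` F" by auto
    ultimately show ?thesis using fin by simp
  qed
  moreover have "\<exists>z\<in>P. incident u z \<and> incident v z" if "u \<in> P" "v \<in> P" for u v
  proof -
    have aff: "\<exists>z\<in>P. incident (Aff x y) z \<and> incident (Aff x' y') z"
      if F: "x \<in> F" "y \<in> F" "x' \<in> F" "y' \<in> F" for x y x' y'
    proof (cases "x = x'")
      case True
      then show ?thesis using F by (intro bexI[of _ "Slope x"]) auto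
    next
      case False
      \<comment> \<open>The slope of the line joining two affine points that are not on a common
        vertical line.\<close>
      define m where "m = (y - y') / (x - x')"
      have "m * (x - x') = y - y'" using False by (simp add: m_def)
      then have "incident (Aff x y) (Aff m (m * x - y))" "incident (Aff x' y') (Aff m (m * x - y))"
        by (auto simp: algebra_simps)
      moreover have "Aff m (m * x - y) \<in> P" using F closed by (simp add: m_def)
      ultimately show ?thesis by blast
    qed
    have aff_slope: "\<exists>z\<in>P. incident (Aff x y) z \<and> incident (Slope a) z"
      if "x \<in> F" "y \<in> F" "a \<in> F" for x y a
      using that closed by (intro bexI[of _ "Aff a (a * x - y)"]) auto
    have aff_inf: "\<exists>z\<in>P. incident (Aff x y) z \<and> incident Infty z" if "x \<in> F" "y \<in> F" for x y
      using that by (intro bexI[of _ "Slope x"]) auto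
    have inf: "\<exists>z\<in>P. incident (Slope a) z \<and> incident (Slope b) z" "\<exists>z\<in>P. incident (Slope a) z \<and> incident Infty z"
      "\<exists>z\<in>P. incident Infty z \<and> incident Infty z" for a b
      by (intro bexI[of _ Infty]; simp)+
    show ?thesis
      using that aff aff_slope aff_inf inf by (cases u; cases v) (simp; blast)+
  qed
  ultimately show ?thesis
    unfolding polar_plane_def using finP incident_commute[THEN iffD1] by (auto simp: power2_eq_square)
qed

text \<open>Powers of two suffice as orders: they approximate any target within a factor of two,
  which only costs a constant in the exponent.\<close>

lemma polar_plane_two_power:
  assumes "k \<ge> 1"
  shows "\<exists>(P :: bit alg_closure pt set). polar_plane (2 ^ k) P incident"
proof -
  have "card (fixed_field k) > 0" using card_fixed_field[OF assms] by simp
  then have "finite (fixed_field k)" by (auto simp: card_gt_0_iff)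
  then show ?thesis
    using polar_plane_of_field[of "fixed_field k"] fixed_field_closed card_fixed_field[OF assms] by auto
qed

section \<open>Counting lines in a polar plane\<close>

lemma card_lines_meeting:
  assumes plane: "polar_plane q P inc" and A: "A \<subseteq> P"
  shows "card {y\<in>P. \<exists>x\<in>A. inc x y} \<le> q * card A + 1"
proof -
  have "finite A" using plane A by (auto simp: polar_plane_def intro: finite_subset)
  then show ?thesis using A
  proof (induction A rule: finite_induct)
    case (insert a A)
    have fin: "finite P" and deg: "card {y\<in>P. inc a y} = q + 1"
      using plane insert.prems by (auto simp: polar_plane_def)
    let ?M = "{y\<in>P. \<exists>x\<in>A. inc x y}" and ?N = "{y\<in>P. inc a y}"
    have eq: "{y\<in>P. \<exists>x\<in>insert a A. inc x y} = ?M \<union> (?N - ?M)" by auto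
    show ?case
    proof (cases "A = {}")
      case True
      then show ?thesis using deg by simp
    next
      case False
      then obtain x where "x \<in> A" by blast
      then obtain z where "z \<in> P" "inc a z" "inc x z"
        using plane insert.prems unfolding polar_plane_def by blast
      \<comment> \<open>The line joining \<open>a\<close> to an earlier point is already counted, so
        every point after the first brings at most \<open>q\<close> new lines.\<close>
      then have "?N - ?M \<subseteq> ?N - {z}" "z \<in> ?N" using \<open>x \<in> A\<close> by auto
      then have "card (?N - ?M) \<le> card (?N - {z})" using fin by (intro card_mono) auto
      also have "\<dots> = q" using deg \<open>z \<in> ?N\<close> by simp
      finally have "card (?N - ?M) \<le> q" .
      then have "card (?M \<union> (?N - ?M)) \<le> card ?M + q"
        using card_Un_le[of ?M "?N - ?M"] by linarith
      then show ?thesis using insert eq by simp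
    qed
  qed simp
qed

text \<open>At most \<open>q\<close> points carry weight \<open>s\<close> or more. The lines avoiding them number at least
  \<open>q\<close> times the deficit \<open>q + 1 - card A\<close>, which matches the remaining total weight.\<close>

lemma light_line:
  fixes w :: "'p \<Rightarrow> nat"
  assumes plane: "polar_plane q P inc" and q: "q \<ge> 1"
    and w: "(\<Sum>x\<in>P. w x) < (q + 1) * s"
  shows "\<exists>y\<in>P. (\<forall>x\<in>P. inc x y \<longrightarrow> w x < s) \<and> (\<Sum>x\<in>{x\<in>P. inc x y}. w x) \<le> 2 * s"
proof (rule ccontr)
  assume contr: "\<not> ?thesis"
  have fin: "finite P" and cP: "card P = q\<^sup>2 + q + 1" using plane by (auto simp: polar_plane_def)
  define A where "A = {x\<in>P. s \<le> w x}"
  define U where "U = {y\<in>P. \<forall>x\<in>A. \<not> inc x y}"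
  have AP: "A \<subseteq> P" and finU: "finite U" and UP: "U \<subseteq> P"
    using fin by (auto simp: A_def U_def)
  have split: "(\<Sum>x\<in>P. w x) = (\<Sum>x\<in>A. w x) + (\<Sum>x\<in>P - A. w x)"
    using sum.subset_diff[OF AP fin, of w] by simp
  have As: "card A * s \<le> (\<Sum>x\<in>A. w x)"
    using sum_bounded_below[of A s w] by (simp add: A_def)
  have "card A * s < (q + 1) * s" using As split w by linarith
  then have "card A < q + 1" by (simp only: mult_less_cancel2)
  then have kq: "card A \<le> q" by simp
  define j where "j = q + 1 - card A"
  have j: "card A + j = q + 1" "j \<ge> 1" using kq by (auto simp: j_def)
  have rest: "(\<Sum>x\<in>P - A. w x) < j * s"
  proof -
    have "(q + 1) * s = card A * s + j * s" using j by (metis add_mult_distrib)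
    then show ?thesis using As split w by linarith
  qed
  have "card U + card {y\<in>P. \<exists>x\<in>A. inc x y} = card P"
  proof -
    have "U \<union> {y\<in>P. \<exists>x\<in>A. inc x y} = P" "U \<inter> {y\<in>P. \<exists>x\<in>A. inc x y} = {}"
      by (auto simp: U_def)
    then show ?thesis using fin finU
      by (metis (no_types, lifting) card_Un_disjoint finite_Un)
  qed
  then have "q\<^sup>2 + q + 1 \<le> card U + (q * card A + 1)"
    using card_lines_meeting[OF plane AP] cP by linarith
  moreover have "q * card A + q * j = q\<^sup>2 + q"
    using j(1) by (metis add_mult_distrib2 mult.right_neutral power2_eq_square)
  ultimately have U: "q * j \<le> card U" by linarith
  have deg: "card {y\<in>U. inc x y} \<le> q + 1" if "x \<in> P" for x
  proof -
    have "card {y\<in>U. inc x y} \<le> card {y\<in>P. inc x y}"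
      using UP fin by (intro card_mono) auto
    then show ?thesis using plane that by (auto simp: polar_plane_def)
  qed
  \<comment> \<open>Double counting of the weight on the lines of \<open>U\<close>: each line would
    carry at least \<open>2 * s + 1\<close>, while each point outside \<open>A\<close> is counted at
    most \<open>q + 1\<close> times.\<close>
  have "(\<Sum>y\<in>U. \<Sum>x\<in>{x\<in>P. inc x y}. w x) = (\<Sum>y\<in>U. \<Sum>x\<in>{x\<in>P - A. inc x y}. w x)"
    by (intro sum.cong) (auto simp: U_def)
  also have "\<dots> = (\<Sum>x\<in>P - A. \<Sum>y\<in>{y\<in>U. inc x y}. w x)"
    using finU fin by (intro sum.swap_restrict) auto
  also have "\<dots> \<le> (\<Sum>x\<in>P - A. (q + 1) * w x)"
    using deg by (intro sum_mono) (simp del: add_Suc mult_Suc)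
  also have "\<dots> \<le> (q + 1) * (j * s)"
    using rest by (simp add: sum_distrib_left[symmetric] del: mult_Suc)
  finally have upper: "(\<Sum>y\<in>U. \<Sum>x\<in>{x\<in>P. inc x y}. w x) \<le> (q + 1) * (j * s)" .
  have "2 * s + 1 \<le> (\<Sum>x\<in>{x\<in>P. inc x y}. w x)" if "y \<in> U" for y
  proof -
    have "\<forall>x\<in>P. inc x y \<longrightarrow> w x < s" using that by (auto simp: U_def A_def not_le)
    then have "\<not> (\<Sum>x\<in>{x\<in>P. inc x y}. w x) \<le> 2 * s" using contr that UP by blast
    then show ?thesis by simp
  qed
  then have "card U * (2 * s + 1) \<le> (\<Sum>y\<in>U. \<Sum>x\<in>{x\<in>P. inc x y}. w x)"
    using sum_bounded_below[of U "2 * s + 1"] by simp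
  then have "q * j * (2 * s + 1) \<le> (q + 1) * (j * s)"
    using upper U by (meson le_trans mult_le_mono1)
  then have "j * (q * (2 * s + 1)) \<le> j * ((q + 1) * s)"
    by (simp only: ac_simps)
  then have "q * (2 * s + 1) \<le> (q + 1) * s" using j(2) by simp
  moreover have "q * s \<ge> s" using q by simp
  ultimately show False using q by (simp add: algebra_simps)
qed

section \<open>The upper bound\<close>

lemma central_binomial_ratio_ge:
  assumes "w < s"
  shows "(1 / 16) ^ w \<le> real (2 * s - 1 - w choose s) / real (2 * s - 1 choose s)"
proof -
  have pos: "0 < real (2 * s - 1 choose s)" using assms by simp
  have "(1 / 16) ^ w * real (2 * s - 1 choose s) \<le> real (2 * s - 1 - w choose s)"
  \<comment> \<open>For large \<open>w\<close> the bound \<open>2 ^ (2 * s - 1)\<close> on the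
    binomial suffices, which gives the constant 16. For small \<open>w\<close> every vertex removed
    from the block costs a factor of at most 4.\<close>
  proof (cases "s \<le> 2 * w")
    case True
    have "real (2 * s - 1 choose s) \<le> 2 ^ (2 * s - 1)"
      by (metis binomial_le_pow2 of_nat_le_iff of_nat_numeral of_nat_power)
    also have "\<dots> \<le> 2 ^ (4 * w)" using True by (intro power_increasing) auto
    finally have "real (2 * s - 1 choose s) \<le> 16 ^ w" by (simp add: power_mult)
    moreover have "1 \<le> real (2 * s - 1 - w choose s)"
      using assms by (simp add: Suc_le_eq)
    ultimately have "real (2 * s - 1 choose s) * 1 \<le> 16 ^ w * real (2 * s - 1 - w choose s)"
      by (intro mult_mono) auto
    then show ?thesis by (simp add: power_divide field_simps)
  next
    case False
    have "2 * v < s \<Longrightarrow> (1 / 4) ^ v * real (2 * s - 1 choose s) \<le> real (2 * s - 1 - v choose s)" for v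
    proof (induction v)
      case (Suc v)
      define N where "N = 2 * s - 1 - v"
      have N: "N \<le> 4 * (N - s)" "N > 0" using Suc.prems by (auto simp: N_def)
      have "N * (N choose s) \<le> 4 * (N - s) * (N choose s)" using N by simp
      also have "\<dots> = N * (4 * (N - 1 choose s))" using binomial_absorb_comp[of N s] by simp
      finally have "N choose s \<le> 4 * (N - 1 choose s)" using N(2) by simp
      then have "real (N choose s) \<le> 4 * real (N - 1 choose s)"
        by (metis of_nat_le_iff of_nat_mult of_nat_numeral)
      moreover have "(1 / 4) ^ v * real (2 * s - 1 choose s) \<le> real (N choose s)"
        using Suc by (simp add: N_def)
      moreover have "N - 1 = 2 * s - 1 - Suc v" by (simp add: N_def)
      ultimately show ?case by simp
    qed simp
    then have "(1 / 4) ^ w * real (2 * s - 1 choose s) \<le> real (2 * s - 1 - w choose s)"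
      using False by simp
    moreover have "(1 / 16) ^ w * real (2 * s - 1 choose s) \<le> (1 / 4) ^ w * real (2 * s - 1 choose s)"
      by (intro mult_right_mono power_mono) auto
    ultimately show ?thesis by linarith
  qed
  then show ?thesis using pos by (simp add: field_simps)
qed

text \<open>With \<open>x = w / m \<le> 1 / 2\<close>, \<open>1 - x \<ge> exp (- 2 * x)\<close>, and
  \<open>ln m \<ge> 1\<close> allows the base \<open>m\<close>. For larger \<open>w\<close> the
  exponent is below \<open>- 1\<close> and the ratio is still at least \<open>1 / m\<close>.\<close>

lemma one_minus_ratio_ge_powr:
  assumes "w < m" "3 \<le> m"
  shows "real m powr (- (2 * real w / real m)) \<le> real (m - w) / real m"
proof (cases "2 * w \<le> m")
  case True
  define x where "x = real w / real m"
  have x: "0 \<le> x" "x \<le> 1 / 2" using True assms by (auto simp: x_def field_simps)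
  have "exp 1 \<le> real m" using exp_le assms(2) by linarith
  then have ln1: "1 \<le> ln (real m)" using assms(2) by (subst ln_ge_iff) auto
  have "real m powr (- (2 * real w / real m)) = exp (- (2 * x * ln (real m)))"
    using assms by (simp add: powr_def x_def)
  also have "\<dots> \<le> exp (- (2 * x))"
    using x ln1 by (simp add: mult_le_cancel_left1)
  also have "\<dots> \<le> exp (ln (1 - x))"
  proof -
    have "x * x \<le> x * (1 / 2)" using x by (intro mult_left_mono) auto
    then have "- (2 * x) \<le> - x - 2 * x\<^sup>2" by (simp add: power2_eq_square)
    also have "\<dots> \<le> ln (1 - x)" using x by (intro ln_one_minus_pos_lower_bound)
    finally show ?thesis by simp
  qed
  also have "\<dots> = real (m - w) / real m"
    using x assms by (simp add: x_def of_nat_diff field_simps)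
  finally show ?thesis .
next
  case False
  then have "real m powr (- (2 * real w / real m)) \<le> real m powr (- 1)"
    using assms by (intro powr_mono) (auto simp: field_simps)
  also have "\<dots> = 1 / real m" using assms by (simp add: powr_minus_divide)
  also have "\<dots> \<le> real (m - w) / real m" using assms by (intro divide_right_mono) auto
  finally show ?thesis .
qed

text \<open>Chance that one random vertex from each block avoids a set of total weight at most
  \<open>2 * m\<close>: in base \<open>r\<close> the exponents of the single factors add up to at
  least \<open>- 4\<close>.\<close>

lemma prod_one_minus_ratio_ge:
  fixes \<rho> w :: "'a \<Rightarrow> nat"
  assumes J: "finite J" and m: "3 \<le> m" and \<rho>: "\<And>j. j \<in> J \<Longrightarrow> m \<le> \<rho> j" "\<And>j. j \<in> J \<Longrightarrow> \<rho> j \<le> r"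
    and w: "\<And>j. j \<in> J \<Longrightarrow> w j < \<rho> j" "(\<Sum>j\<in>J. w j) \<le> 2 * m" and r: "1 \<le> r"
  shows "1 / real r ^ 4 \<le> (\<Prod>j\<in>J. real (\<rho> j - w j) / real (\<rho> j))"
proof -
  have "1 / real r ^ 4 = real r powr (- 4)"
    using r by (simp add: powr_minus_divide powr_numeral)
  also have "\<dots> \<le> real r powr (\<Sum>j\<in>J. - (2 * real (w j) / real m))"
  proof (rule powr_mono)
    have "(\<Sum>j\<in>J. 2 * real (w j) / real m) = 2 * real (\<Sum>j\<in>J. w j) / real m"
      by (simp add: sum_distrib_left sum_divide_distrib)
    also have "\<dots> \<le> 2 * real (2 * m) / real m"
      using w(2) by (intro divide_right_mono mult_left_mono of_nat_mono) auto
    also have "\<dots> = 4" using m by simp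
    finally show "- 4 \<le> (\<Sum>j\<in>J. - (2 * real (w j) / real m))" by (simp add: sum_negf)
  qed (use r in simp)
  also have "\<dots> = (\<Prod>j\<in>J. real r powr (- (2 * real (w j) / real m)))"
    using J r by (simp add: powr_sum)
  also have "\<dots> \<le> (\<Prod>j\<in>J. real (\<rho> j - w j) / real (\<rho> j))"
  proof (rule prod_mono, intro conjI)
    fix j assume j: "j \<in> J"
    have "real r powr (- (2 * real (w j) / real m)) \<le> real (\<rho> j) powr (- (2 * real (w j) / real m))"
      using \<rho>[OF j] m by (intro powr_mono2') auto
    also have "\<dots> \<le> real (\<rho> j) powr (- (2 * real (w j) / real (\<rho> j)))"
      using \<rho>[OF j] m by (intro powr_mono) (auto intro!: divide_left_mono)
    also have "\<dots> \<le> real (\<rho> j - w j) / real (\<rho> j)"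
      using \<rho>[OF j] m w(1)[OF j] by (intro one_minus_ratio_ge_powr) auto
    finally show "real r powr (- (2 * real (w j) / real m)) \<le> real (\<rho> j - w j) / real (\<rho> j)" .
  qed simp
  finally show ?thesis .
qed

text \<open>The profile \<open>line y\<close> takes \<open>s\<close> out of \<open>2 * s - 1\<close> copies of every point of a line and one
  vertex from each of \<open>t\<close> additional blocks of sizes \<open>m + 1, \<dots>, m + t\<close>; the profile
  \<open>extra i\<close> takes the whole \<open>i\<close>-th additional block and one vertex from each later one. Given
  a candidate cover, let \<open>i\<close> be the last additional block that it avoids: \<open>extra i\<close> works, and if
  there is none, too few vertices remain to block the lines.\<close>

lemma plane_min_edges:
  fixes P :: "'p set"
  assumes plane: "polar_plane q P inc" and q: "q \<ge> 2" and s: "s \<ge> 1" and t: "t \<le> q"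
    and r: "r = (q + 1) * s + t"
    and N: "N = (q\<^sup>2 + q + 1) * (2 * s - 1) + (\<Sum>j=1..t. (q + 1) * s + j)" "N \<le> n"
  shows "min_edges n r \<le> (q + 1)\<^sup>2 * (N * r ^ 4 * 256 ^ s)"
proof -
  define m where "m = (q + 1) * s"
  have "(q + 1) * 1 \<le> m" unfolding m_def using s by (intro mult_le_mono2)
  then have m: "q + 1 \<le> m" "3 \<le> m" and rm: "r = m + t" using q r by (auto simp: m_def)
  have fin: "finite P" and cP: "card P = q\<^sup>2 + q + 1"
    and sym: "\<And>x y. x \<in> P \<Longrightarrow> y \<in> P \<Longrightarrow> inc x y \<longleftrightarrow> inc y x"
    and deg: "\<And>x. x \<in> P \<Longrightarrow> card {y\<in>P. inc x y} = q + 1"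
    and join: "\<And>x y. x \<in> P \<Longrightarrow> y \<in> P \<Longrightarrow> \<exists>z\<in>P. inc x z \<and> inc y z"
    using plane unfolding polar_plane_def by blast+
  define I where "I = P <+> {1..t}"
  define b :: "'p + nat \<Rightarrow> nat" where "b = case_sum (\<lambda>_. 2 * s - 1) (\<lambda>j. m + j)"
  define line :: "'p \<Rightarrow> 'p + nat \<Rightarrow> nat"
    where "line y = case_sum (\<lambda>x. if inc x y then s else 0) (\<lambda>_. 1)" for y
  define extra :: "nat \<Rightarrow> 'p + nat \<Rightarrow> nat"
    where "extra i = case_sum (\<lambda>_. 0) (\<lambda>j. if j < i then 0 else if j = i then m + i else 1)" for i
  define D where "D = line ` P \<union> extra ` {1..t}"
  have finI: "finite I" using fin by (simp add: I_def)
  have sum_I: "(\<Sum>a\<in>I. g a) = (\<Sum>x\<in>P. g (Inl x)) + (\<Sum>j=1..t. g (Inr j))" for g :: "_ \<Rightarrow> nat"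
    using fin by (simp add: I_def sum.Plus comp_def)
  have prod_I: "(\<Prod>a\<in>I. g a) = (\<Prod>x\<in>P. g (Inl x)) * (\<Prod>j=1..t. g (Inr j))" for g :: "_ \<Rightarrow> real"
    using fin by (simp add: I_def prod.Plus comp_def)
  have "card D \<le> card P + t"
    unfolding D_def using card_Un_le[of "line ` P" "extra ` {1..t}"]
      card_image_le[OF fin, of line] card_image_le[of "{1..t}" extra] by simp
  also have "\<dots> \<le> (q + 1)\<^sup>2" using cP t by (simp add: power2_eq_square)
  finally have card_D: "card D \<le> (q + 1)\<^sup>2" .
  have r1: "1 \<le> r" using rm m by simp
  \<comment> \<open>The factor \<open>r ^ 4\<close> comes from the additional blocks and
    \<open>256 ^ s = 16 ^ (2 * s)\<close> from a line of weight at most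
    \<open>2 * s\<close>.\<close>
  define p :: real where "p = 1 / (real r ^ 4 * 256 ^ s)"
  have r4: "1 \<le> real r ^ 4" using r1 by (intro one_le_power) simp
  have ge1: "(1::real) \<le> real r ^ 4 * 256 ^ s"
    using mult_mono[OF r4 one_le_power[of "256::real" s]] by simp
  have "min_edges n r \<le> card D * (N * r ^ 4 * 256 ^ s)"
  proof (rule profile_min_edges[OF finI, of D r b N n p])
    show "finite D" using fin by (simp add: D_def)
    show "(\<Sum>a\<in>I. b a) = N" unfolding sum_I N by (simp add: b_def cP m_def)
    have "1 \<le> (q\<^sup>2 + q + 1) * (2 * s - 1)" using s by simp
    then show "1 \<le> N" unfolding N by linarith
    show "0 < p" "p \<le> 1" using ge1 by (auto simp: p_def field_simps)
    show "real N / p \<le> real (N * r ^ 4 * 256 ^ s)" by (simp add: p_def)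
  next
    fix d assume "d \<in> D"
    then consider y where "y \<in> P" "d = line y" | i where "i \<in> {1..t}" "d = extra i"
      by (auto simp: D_def)
    then show "(\<Sum>a\<in>I. d a) = r"
    proof cases
      case 1
      have "{x\<in>P. inc x y} = {x\<in>P. inc y x}" using sym 1 by blast
      then have "(\<Sum>x\<in>P. if inc x y then s else 0) = (q + 1) * s"
        using deg[OF 1(1)] fin by (simp add: sum.inter_filter[symmetric] del: mult_Suc)
      then show ?thesis unfolding sum_I 1 by (simp add: line_def r)
    next
      case 2
      have "(\<Sum>j=1..t. if j < i then 0 else if j = i then m + i else 1)
          = (\<Sum>j=i..t. if j < i then 0 else if j = i then m + i else 1)"
        using 2 by (intro sum.mono_neutral_right) auto
      also have "\<dots> = m + i + (\<Sum>j=i+1..t. if j < i then 0 else if j = i then m + i else 1)"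
        using 2 by (simp add: sum.atLeast_Suc_atMost)
      also have "(\<Sum>j=i+1..t. if j < i then 0 else if j = i then m + i else 1) = (\<Sum>j=i+1..t. 1)"
        by (intro sum.cong) auto
      finally show ?thesis unfolding sum_I 2 using 2 by (simp add: extra_def rm)
    qed
  next
    fix d d' assume "d \<in> D" "d' \<in> D"
    have line_line: "\<exists>a\<in>I. b a < line y a + line y' a" if y: "y \<in> P" "y' \<in> P" for y y'
    proof -
      obtain z where "z \<in> P" "inc y z" "inc y' z" using join y by blast
      then show ?thesis using sym y s by (intro bexI[of _ "Inl z"]) (auto simp: I_def line_def b_def)
    qed
    have line_extra: "\<exists>a\<in>I. b a < line y a + extra i a" if "i \<in> {1..t}" for y i
      using that by (intro bexI[of _ "Inr i"]) (auto simp: I_def line_def extra_def b_def)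
    \<comment> \<open>The later of the two blocks is taken whole by one profile and touched by the
      other.\<close>
    have extra_extra: "\<exists>a\<in>I. b a < extra i a + extra i' a" if "i \<in> {1..t}" "i' \<in> {1..t}" for i i'
      using that m by (intro bexI[of _ "Inr (max i i')"]) (auto simp: I_def extra_def b_def max_def)
    show "\<exists>a\<in>I. b a < d a + d' a"
    proof -
      have "d \<in> line ` P \<or> d \<in> extra ` {1..t}" "d' \<in> line ` P \<or> d' \<in> extra ` {1..t}"
        using \<open>d \<in> D\<close> \<open>d' \<in> D\<close> by (auto simp: D_def)
      then show ?thesis
      proof (elim disjE imageE)
        fix i y assume "d = extra i" "i \<in> {1..t}" "d' = line y"
        then show ?thesis using line_extra[of i y] by (simp add: add.commute)
      qed (use line_line line_extra extra_extra in simp_all)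
    qed
  next
    fix w assume w_le: "\<And>a. a \<in> I \<Longrightarrow> w a \<le> b a" and w_sum: "(\<Sum>a\<in>I. w a) < r"
    define v where "v j = w (Inr j)" for j
    have v_sum: "(\<Sum>x\<in>P. w (Inl x)) + (\<Sum>j=1..t. v j) < r"
      using w_sum by (simp add: sum_I v_def)
    \<comment> \<open>The value 0 stands for the case that every additional block is hit.\<close>
    define i where "i = Max (insert 0 {j\<in>{1..t}. v j = 0})"
    have "i \<in> insert 0 {j\<in>{1..t}. v j = 0}" unfolding i_def by (rule Max_in) auto
    then have i: "i = 0 \<or> i \<in> {1..t} \<and> v i = 0" by auto
    have above: "v j \<ge> 1" if "j \<in> {i+1..t}" for j
    proof (rule ccontr)
      assume "\<not> 1 \<le> v j"
      then have "j \<le> i" unfolding i_def using that by (intro Max_ge) auto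
      then show False using that by simp
    qed
    \<comment> \<open>No block after \<open>i\<close> is exhausted: each of the \<open>t - j\<close>
      blocks after \<open>j\<close> uses up a vertex, and fewer than \<open>m + t\<close> are
      available.\<close>
    have v_less: "v j < m + j" if j: "j \<in> {i+1..t}" for j
    proof -
      have "(\<Sum>j'=j+1..t. 1) \<le> (\<Sum>j'=j+1..t. v j')" using j above by (intro sum_mono) auto
      then have "v j + (t - j) \<le> (\<Sum>j'=j..t. v j')"
        using j by (simp add: sum.atLeast_Suc_atMost)
      also have "\<dots> \<le> (\<Sum>j=1..t. v j)" using j by (intro sum_mono2) auto
      finally show ?thesis using v_sum rm j by simp
    qed
    have tail: "1 / real r ^ 4 \<le> (\<Prod>j=i+1..t. real (m + j - v j) / real (m + j))"
    proof (rule prod_one_minus_ratio_ge[OF _ m(2)])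
      have "(\<Sum>j=i+1..t. v j) \<le> (\<Sum>j=1..t. v j)" by (intro sum_mono2) auto
      then show "(\<Sum>j=i+1..t. v j) \<le> 2 * m" using v_sum rm t m by simp
    qed (use v_less r1 rm in auto)
    show "\<exists>d\<in>D. p \<le> (\<Prod>a\<in>I. real (b a - w a choose d a) / real (b a choose d a))"
    proof (cases "i = 0")
      case False
      then have i: "i \<in> {1..t}" "v i = 0" using i by auto
      \<comment> \<open>Blocks in which nothing is chosen contribute 1, and so does block
        \<open>i\<close>, which is free of the candidate cover; only the later blocks
        matter.\<close>
      have "(\<Prod>a\<in>I. real (b a - w a choose extra i a) / real (b a choose extra i a))
        = (\<Prod>j=1..t. real (m + j - v j choose extra i (Inr j)) / real (m + j choose extra i (Inr j)))"
        unfolding prod_I by (simp add: b_def v_def extra_def)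
      also have "\<dots> = (\<Prod>j=i+1..t. real (m + j - v j choose extra i (Inr j)) / real (m + j choose extra i (Inr j)))"
        using i by (intro prod.mono_neutral_right) (auto simp: extra_def)
      also have "\<dots> = (\<Prod>j=i+1..t. real (m + j - v j) / real (m + j))"
        by (intro prod.cong) (auto simp: extra_def)
      finally have "1 / real r ^ 4 \<le> (\<Prod>a\<in>I. real (b a - w a choose extra i a) / real (b a choose extra i a))"
        using tail by simp
      moreover have "p \<le> 1 / real r ^ 4"
      proof -
        have "real r ^ 4 * 1 \<le> real r ^ 4 * 256 ^ s" by (intro mult_left_mono) auto
        then show ?thesis unfolding p_def using r1 by (intro divide_left_mono) auto
      qed
      ultimately show ?thesis using i by (intro bexI[of _ "extra i"]) (auto simp: D_def)
    next
      case True
      \<comment> \<open>The \<open>t\<close> additional blocks absorb at least \<open>t\<close>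
        vertices, leaving fewer than \<open>r - t = (q + 1) * s\<close> for the plane.\<close>
      have "(\<Sum>j=1..t. 1) \<le> (\<Sum>j=1..t. v j)" using above True by (intro sum_mono) auto
      then have "(\<Sum>x\<in>P. w (Inl x)) < (q + 1) * s" using v_sum rm m_def by simp
      then obtain y where y: "y \<in> P" "\<And>x. x \<in> P \<Longrightarrow> inc x y \<Longrightarrow> w (Inl x) < s"
        "(\<Sum>x\<in>{x\<in>P. inc x y}. w (Inl x)) \<le> 2 * s"
        using light_line[OF plane, of "\<lambda>x. w (Inl x)" s] q by auto
      let ?f = "\<lambda>x. real (2 * s - 1 - w (Inl x) choose s) / real (2 * s - 1 choose s)"
      have "1 / 256 ^ s = ((1 / 16) ^ (2 * s) :: real)" by (simp add: power_mult power_divide)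
      also have "\<dots> \<le> (1 / 16) ^ (\<Sum>x\<in>{x\<in>P. inc x y}. w (Inl x))"
        using y(3) by (intro power_decreasing) auto
      also have "\<dots> = (\<Prod>x\<in>{x\<in>P. inc x y}. (1 / 16) ^ w (Inl x))" by (simp add: power_sum)
      also have "\<dots> \<le> (\<Prod>x\<in>{x\<in>P. inc x y}. ?f x)"
        using y(2) central_binomial_ratio_ge by (intro prod_mono) auto
      also have "\<dots> = (\<Prod>x\<in>P. if inc x y then ?f x else 1)"
        by (rule prod.inter_filter[OF fin])
      also have "\<dots> = (\<Prod>x\<in>P. real (b (Inl x) - w (Inl x) choose line y (Inl x)) / real (b (Inl x) choose line y (Inl x)))"
        by (intro prod.cong) (auto simp: b_def line_def)
      finally have head: "1 / 256 ^ s \<le> \<dots>" .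
      have "(\<Prod>j=i+1..t. real (m + j - v j) / real (m + j)) =
         (\<Prod>j=1..t. real (b (Inr j) - w (Inr j) choose line y (Inr j)) / real (b (Inr j) choose line y (Inr j)))"
        using True by (simp add: b_def line_def v_def)
      then have "1 / 256 ^ s * (1 / real r ^ 4) \<le>
          (\<Prod>a\<in>I. real (b a - w a choose line y a) / real (b a choose line y a))"
        unfolding prod_I using head tail by (intro mult_mono) (auto intro!: prod_nonneg)
      then have "p \<le> (\<Prod>a\<in>I. real (b a - w a choose line y a) / real (b a choose line y a))"
        by (simp add: p_def mult.commute)
      then show ?thesis using y(1) by (intro bexI[of _ "line y"]) (auto simp: D_def)
    qed
  qed (use r1 N in auto)
  also have "\<dots> \<le> (q + 1)\<^sup>2 * (N * r ^ 4 * 256 ^ s)" using card_D by (intro mult_le_mono1)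
  finally show ?thesis .
qed

section \<open>Choice of parameters and the final bounds\<close>

lemma min_edges_le_plane_bound:
  assumes r: "r \<ge> 2" and n: "8 * r \<le> n" "n \<le> 3 * r\<^sup>2"
  shows "real (min_edges n r) \<le> (real n / real r) powr (240 * (real r)\<^sup>2 / real n)"
proof -
  \<comment> \<open>The order \<open>q = 2 ^ (k - 1)\<close> is the largest power of two with
    \<open>(3 * q + 2) * r \<le> n\<close>. This quantity bounds the number \<open>N\<close> of
    vertices used, and maximality makes \<open>q\<close> comparable to \<open>n / r\<close>.\<close>
  define k where "k = (LEAST k. n < (3 * 2 ^ k + 2) * r)"
  have "n < (3 * 2 ^ n + 2) * r"
  proof -
    have "n < 2 ^ n" by simp
    also have "\<dots> \<le> (3 * 2 ^ n + 2) * 1" by simp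
    also have "\<dots> \<le> (3 * 2 ^ n + 2) * r" using r by (intro mult_le_mono2) simp
    finally show ?thesis .
  qed
  then have k: "n < (3 * 2 ^ k + 2) * r" unfolding k_def by (rule LeastI)
  have k2: "k \<ge> 2"
  proof (rule ccontr)
    assume "\<not> k \<ge> 2"
    then have "k = 0 \<or> k = 1" by auto
    then show False using k n r by auto
  qed
  define q where "q = (2::nat) ^ (k - 1)"
  have "k - 1 < k" using k2 by simp
  then have "\<not> n < (3 * 2 ^ (k - 1) + 2) * r" unfolding k_def by (rule not_less_Least)
  then have "\<not> n < (3 * q + 2) * r" unfolding q_def .
  then have qn: "(3 * q + 2) * r \<le> n" by simp
  have "2 ^ k = 2 * q" unfolding q_def using k2 by (simp add: power_eq_if)
  then have nq: "n < (6 * q + 2) * r" using k by simp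
  have "(2::nat) ^ 1 \<le> 2 ^ (k - 1)" using k2 by (intro power_increasing) auto
  then have q: "q \<ge> 2" by (simp add: q_def)
  \<comment> \<open>Here \<open>n \<le> 3 * r\<^sup>2\<close> enters: it yields
    \<open>q + 1 \<le> r\<close>, so that \<open>s \<ge> 1\<close>.\<close>
  have "(3 * q + 2) * r \<le> (3 * r) * r" using qn n(2) by (simp add: power2_eq_square)
  then have "0 < r \<longrightarrow> 3 * q + 2 \<le> 3 * r" by (simp only: mult_le_cancel2)
  then have qr: "q + 1 \<le> r" using r by linarith
  have "1 \<le> k - 1" using k2 by simp
  from polar_plane_two_power[OF this]
  obtain P :: "bit alg_closure pt set" where P: "polar_plane q P incident"
    unfolding q_def by blast
  define s where "s = r div (q + 1)"
  define t where "t = r mod (q + 1)"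
  have rst: "r = (q + 1) * s + t" unfolding s_def t_def by (rule mult_div_mod_eq[symmetric])
  have t: "t \<le> q" using mod_less_divisor[of "q + 1" r] by (simp add: t_def)
  have s: "s \<ge> 1" using div_le_mono[OF qr, of "q + 1"] by (simp add: s_def)
  define N where "N = (q\<^sup>2 + q + 1) * (2 * s - 1) + (\<Sum>j=1..t. (q + 1) * s + j)"
  have "N \<le> 2 * (q + 1) * r + q * r"
  proof -
    have "(q\<^sup>2 + q + 1) * (2 * s - 1) \<le> (q + 1)\<^sup>2 * (2 * s)"
      by (intro mult_le_mono) (auto simp: power2_eq_square)
    also have "\<dots> = 2 * (q + 1) * ((q + 1) * s)" by (simp only: power2_eq_square ac_simps)
    also have "\<dots> \<le> 2 * (q + 1) * r" using rst by (intro mult_le_mono2) linarith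
    finally have "(q\<^sup>2 + q + 1) * (2 * s - 1) \<le> 2 * (q + 1) * r" .
    moreover have "(\<Sum>j=1..t. (q + 1) * s + j) \<le> (\<Sum>j=1..t. r)"
      by (intro sum_mono) (use rst in auto)
    moreover have "(\<Sum>j=1..t. r) \<le> q * r" using t by simp
    ultimately show ?thesis unfolding N_def by linarith
  qed
  also have "\<dots> = (3 * q + 2) * r" by (simp add: algebra_simps)
  finally have Nn: "N \<le> n" using qn by linarith
  \<comment> \<open>Lets the factors polynomial in \<open>r\<close> be absorbed into a power of
    \<open>q\<close> with exponent linear in \<open>s\<close>.\<close>
  have r_le: "r \<le> q ^ (s + 2)"
  proof -
    have "r \<le> (q + 1) * (s + 1)" using rst t by (simp add: algebra_simps)
    also have "\<dots> \<le> (q * q) * q ^ s"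
    proof (rule mult_le_mono)
      have "q * 2 \<le> q * q" using q by (intro mult_le_mono2)
      then show "q + 1 \<le> q * q" using q by linarith
      have "s + 1 \<le> 2 ^ s" using less_exp[of s] by linarith
      also have "\<dots> \<le> q ^ s" using q by (intro power_mono) auto
      finally show "s + 1 \<le> q ^ s" .
    qed
    finally show ?thesis by (simp add: power_add power2_eq_square mult.commute)
  qed
  have "min_edges n r \<le> (q + 1)\<^sup>2 * (N * r ^ 4 * 256 ^ s)"
    by (rule plane_min_edges[OF P q s t rst N_def Nn])
  also have "\<dots> \<le> r\<^sup>2 * (4 * r\<^sup>2 * r ^ 4 * 256 ^ s)"
    using qr Nn n(2) by (intro mult_le_mono power_mono) auto
  also have "\<dots> = 4 * (r ^ 8 * (2 ^ 8) ^ s)"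
    by (simp add: power_add[symmetric])
  also have "\<dots> \<le> q\<^sup>2 * ((q ^ (s + 2)) ^ 8 * (q ^ 8) ^ s)"
  proof (intro mult_le_mono power_mono r_le)
    have "2\<^sup>2 \<le> q\<^sup>2" using q by (intro power_mono) auto
    then show "4 \<le> q\<^sup>2" by simp
  qed (use q in auto)
  also have "\<dots> = q ^ (16 * s + 18)"
    by (simp add: power_mult[symmetric] power_add[symmetric] algebra_simps)
  also have "\<dots> \<le> q ^ (40 * s)" using q s by (intro power_increasing) auto
  finally have "real (min_edges n r) \<le> real (q ^ (40 * s))" by (rule of_nat_mono)
  also have "\<dots> = real q powr (40 * real s)" using q by (simp add: powr_realpow[symmetric])
  also have "\<dots> \<le> (real n / real r) powr (40 * real s)"
  proof (rule powr_mono2)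
    have "q * r \<le> n" using qn by (simp add: algebra_simps)
    then have "real q * real r \<le> real n" by (metis of_nat_le_iff of_nat_mult)
    then show "real q \<le> real n / real r" using r by (simp add: field_simps)
  qed auto
  also have "\<dots> \<le> (real n / real r) powr (240 * (real r)\<^sup>2 / real n)"
  proof (rule powr_mono)
    \<comment> \<open>Since \<open>(q + 1) * s \<le> r\<close>, this gives
      \<open>s * n \<le> 6 * r\<^sup>2\<close>, and 240 is 40 times 6.\<close>
    have "n \<le> 6 * (q + 1) * r" using nq by (simp add: algebra_simps)
    then have "s * n \<le> s * (6 * (q + 1) * r)" by (rule mult_le_mono2)
    also have "\<dots> = 6 * ((q + 1) * s) * r" by (simp only: ac_simps)
    also have "\<dots> \<le> 6 * r * r" using rst by (intro mult_le_mono) auto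
    finally have "real (s * n) \<le> real (6 * r * r)" by (rule of_nat_mono)
    then have "real s * real n \<le> 6 * (real r)\<^sup>2" by (simp add: power2_eq_square)
    moreover have "real n > 0" using n r by simp
    ultimately show "40 * real s \<le> 240 * (real r)\<^sup>2 / real n" by (simp add: field_simps)
    have "1 * r \<le> n" using n by simp
    then show "1 \<le> real n / real r" using r by (simp add: field_simps)
  qed
  finally show ?thesis .
qed

text \<open>For \<open>n < 8 * r\<close> the exponent is at least \<open>30 * r\<close> and the base
  at least 3/2, so the trivial bound \<open>2 ^ (2 * r - 1)\<close> suffices.\<close>

lemma min_edges_le_quadratic_range:
  assumes r: "r \<ge> 2" and n: "2 * r - 1 \<le> n" "n \<le> 3 * r\<^sup>2"
  shows "real (min_edges n r) \<le> (real n / real r) powr (240 * (real r)\<^sup>2 / real n)"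
proof (cases "8 * r \<le> n")
  case True
  then show ?thesis using min_edges_le_plane_bound r n by blast
next
  case False
  have "min_edges n r \<le> 2 ^ (2 * r - 1)" using min_edges_le_two_power r n by simp
  also have "\<dots> \<le> 2 ^ (2 * r)" by (intro power_increasing) auto
  finally have "real (min_edges n r) \<le> real (2 ^ (2 * r))" by (rule of_nat_mono)
  also have "\<dots> = 4 ^ r" by (simp add: power_mult)
  also have "\<dots> \<le> ((3 / 2) ^ 30) ^ r" by (intro power_mono) (auto simp: power_divide)
  also have "\<dots> = (3 / 2) ^ (30 * r)" by (simp only: power_mult)
  also have "\<dots> = (3 / 2) powr real (30 * r)" by (subst powr_realpow) auto
  also have "\<dots> = (3 / 2) powr (30 * real r)" by (simp only: of_nat_mult of_nat_numeral)
  also have "\<dots> \<le> (real n / real r) powr (30 * real r)"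
    using n(1) r by (intro powr_mono2) (auto simp: field_simps)
  also have "\<dots> \<le> (real n / real r) powr (240 * (real r)\<^sup>2 / real n)"
  proof (rule powr_mono)
    have "real n \<le> 8 * real r" "real n > 0" using False n r by auto
    then have "30 * real r * real n \<le> 30 * real r * (8 * real r)"
      by (intro mult_left_mono) auto
    then show "30 * real r \<le> 240 * (real r)\<^sup>2 / real n"
      using \<open>real n > 0\<close> by (simp add: field_simps power2_eq_square)
    show "1 \<le> real n / real r" using n r by (simp add: field_simps)
  qed
  finally show ?thesis .
qed

theorem theorem1p1:
  fixes K :: real
  assumes "K > 0"
  shows "\<exists>c C :: real. c > 0 \<and> C > 0 \<and>
    (\<forall>r n :: nat. 2 \<le> r \<longrightarrow> 2 * r - 1 \<le> n \<longrightarrow> real n \<le> K * (real r)\<^sup>2 \<longrightarrow>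
       2 powr (c * (real r)\<^sup>2 / real n) \<le> real (min_edges n r) \<and>
       real (min_edges n r) \<le> 2 powr (C * ((real r)\<^sup>2 / real n) * log 2 (real n / real r)) \<and>
       2 powr (C * ((real r)\<^sup>2 / real n) * log 2 (real n / real r))
         = (real n / real r) powr (C * (real r)\<^sup>2 / real n))"
proof -
  \<comment> \<open>The summand 240 serves \<open>n \<le> 3 * r\<^sup>2\<close>. Beyond that,
    monotonicity reduces to \<open>n = 3 * r\<^sup>2\<close>, where the exponent is 80, and
    \<open>80 \<le> 80 * K * r\<^sup>2 / n\<close>.\<close>
  define C where "C = 240 + 80 * K"
  have bounds: "2 powr (1 / 2 * (real r)\<^sup>2 / real n) \<le> real (min_edges n r) \<and>
       real (min_edges n r) \<le> 2 powr (C * ((real r)\<^sup>2 / real n) * log 2 (real n / real r)) \<and>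
       2 powr (C * ((real r)\<^sup>2 / real n) * log 2 (real n / real r))
         = (real n / real r) powr (C * (real r)\<^sup>2 / real n)"
    if r: "2 \<le> r" and n: "2 * r - 1 \<le> n" and nK: "real n \<le> K * (real r)\<^sup>2" for r n :: nat
  proof -
    have n0: "real n > 0" and base: "1 \<le> real n / real r" using r n by (auto simp: field_simps)
    obtain V :: "nat set" and E where "admissible n r V E" "card E = min_edges n r"
      using min_edges_attained[of r n] r n by auto
    then have lower: "2 powr (1 / 2 * (real r)\<^sup>2 / real n) \<le> real (min_edges n r)"
      using admissible_card_edges_ge r by metis
    have eq: "2 powr (C * ((real r)\<^sup>2 / real n) * log 2 (real n / real r))
         = (real n / real r) powr (C * (real r)\<^sup>2 / real n)"
      using base n0 r by (simp add: powr_def log_def)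
    have upper: "real (min_edges n r) \<le> (real n / real r) powr (C * (real r)\<^sup>2 / real n)"
    proof (cases "n \<le> 3 * r\<^sup>2")
      case True
      then have "real (min_edges n r) \<le> (real n / real r) powr (240 * (real r)\<^sup>2 / real n)"
        using min_edges_le_quadratic_range r n by blast
      also have "\<dots> \<le> (real n / real r) powr (C * (real r)\<^sup>2 / real n)"
        using assms base by (intro powr_mono divide_right_mono mult_right_mono) (auto simp: C_def)
      finally show ?thesis .
    next
      case False
      have "r * 1 \<le> r * r" using r by (intro mult_le_mono2) simp
      then have "2 * r \<le> 3 * r\<^sup>2" unfolding power2_eq_square by linarith
      then have r3: "2 * r - 1 \<le> 3 * r\<^sup>2" by (rule le_trans[OF diff_le_self])
      have "min_edges n r \<le> min_edges (3 * r\<^sup>2) r"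
        using min_edges_antimono[OF _ r3] False r by simp
      then have "real (min_edges n r) \<le> real (min_edges (3 * r\<^sup>2) r)" by (rule of_nat_mono)
      also have "\<dots> \<le> (real (3 * r\<^sup>2) / real r) powr (240 * (real r)\<^sup>2 / real (3 * r\<^sup>2))"
        using min_edges_le_quadratic_range[OF r r3] by simp
      also have "\<dots> = (3 * real r) powr 80" using r by (simp add: power2_eq_square)
      also have "\<dots> \<le> (real n / real r) powr 80"
      proof (rule powr_mono2)
        have "real (3 * r\<^sup>2) \<le> real n" using False by (intro of_nat_mono) simp
        then show "3 * real r \<le> real n / real r" using r by (simp add: field_simps power2_eq_square)
      qed auto
      also have "\<dots> \<le> (real n / real r) powr (C * (real r)\<^sup>2 / real n)"
      proof (rule powr_mono)
        have "80 * real n \<le> 80 * K * (real r)\<^sup>2" using nK by simp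
        also have "\<dots> \<le> C * (real r)\<^sup>2" by (intro mult_right_mono) (auto simp: C_def)
        finally show "80 \<le> C * (real r)\<^sup>2 / real n" using n0 by (simp add: field_simps)
      qed (rule base)
      finally show ?thesis .
    qed
    show ?thesis using lower upper unfolding eq by simp
  qed
  show ?thesis
  proof (rule exI[of _ "1 / 2"], rule exI[of _ C], intro conjI)
    show "0 < C" using assms by (simp add: C_def)
  qed (use bounds in \<open>simp, blast\<close>)
qed

end
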